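(* For $f,h\in C^\infty(\mathfrak M)_{\mathrm{red}}$, the first reduced Poisson bracket is given, with all derivatives at $(e^q,J)$, by $$\{f,h\}_1^{\mathrm{red}}(e^q,J)=\langle\nabla_1f,(d_2h)^-_0\rangle-\langle\nabla_1h,(d_2f)^-_0\rangle+\langle R(q)[d_2f,J]^+,(d_2h)^-\rangle-\langle R(q)[d_2h,J]^+,(d_2f)^-\rangle+\langle J^+,[(d_2f)^-,(d_2h)^-]-[(d_2f)^+,(d_2h)^+]\rangle .$$ If $h$ is the restriction $H\circ\iota$ of any of the functions $H_k(g,J)=\frac1k\Re\operatorname{tr}(J^k)$ or $\tilde H_k(g,J)=\frac1k\Im\operatorname{tr}(J^k)$ ($k\ge1$), this can be written as $$\{f,h\}_1^{\mathrm{red}}(e^q,J)=\langle\nabla_1f,(d_2h)^-_0\rangle+\langle d_2f,[R(q)(d_2h)^--(d_2h)^+,J]\rangle .$$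
   Context: $G=\mathrm{GL}(n,\mathbb C)$ (real Lie group), $\mathcal G=\mathfrak{gl}(n,\mathbb C)$ (real Lie algebra) with $\langle X,Y\rangle=\Re\operatorname{tr}(XY)$. $\mathcal G^+=\mathfrak u(n)$ (anti-Hermitian), $\mathcal G^-=\mathrm i\,\mathfrak u(n)$ (Hermitian); $X=X^++X^-$ with $X^\pm=\frac12(X\mp X^* )$; $\mathcal G^\pm_0$ are the diagonal matrices in $\mathcal G^\pm$, and $X^-_0$ is the diagonal part of $X^-$. $\mathfrak M=G\times\mathcal G=\{(g,J)\}$. For $F\in C^\infty(\mathfrak M,\mathbb R)$: $\langle\nabla_1F,X\rangle=\frac{d}{dt}|_0F(e^{tX}g,J)$, $\langle d_2F,X\rangle=\frac{d}{dt}|_0F(g,J+tX)$ for $X\in\mathcal G$. The first Poisson bracket on $\mathfrak M$ is $\{F,H\}_1=\langle \nabla_1F,d_2H\rangle-\langle\nabla_1H,d_2F\rangle+\langle J,[d_2F,d_2H]\rangle$. For $\eta\in\mathrm U(n)$, $\mathcal R_\eta(g,J)=(g\eta^{-1},J)$, $\mathcal L_\eta(g,J)=(\eta g,\eta J\eta^{-1})$; $C^\infty(\mathfrak M)^{\mathrm U(n)\times\mathrm U(n)}$ is the set of smooth real functions invariant under all these maps (it is closed under $\{\ ,\ \}_1$). Let $\mathfrak M_0^{\mathrm{reg}}=\{(e^q,J): J\in\mathcal G,\ q=\mathrm{diag}(q_1,\dots,q_n)\in\mathcal G^-_0,\ q_1>\dots>q_n\}$ with inclusion $\iota:\mathfrak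 M_0^{\mathrm{reg}}\to\mathfrak M$, and $C^\infty(\mathfrak M)_{\mathrm{red}}=\{F\circ\iota: F\in C^\infty(\mathfrak M)^{\mathrm U(n)\times\mathrm U(n)}\}$. The reduced bracket is $\{F\circ\iota,H\circ\iota\}_1^{\mathrm{red}}=\{F,H\}_1\circ\iota$. For $f\in C^\infty(\mathfrak M_0^{\mathrm{reg}})$: $\nabla_1f\in\mathcal G^-_0$ with $\langle\nabla_1f,X_0\rangle=\frac{d}{dt}|_0f(e^{q+tX_0},J)$ for $X_0\in\mathcal G_0^-$, and $d_2f\in\mathcal G$ with $\langle d_2f,X\rangle=\frac{d}{dt}|_0f(e^q,J+tX)$. $R(q)\in\mathrm{End}(\mathcal G)$: $(R(q)X)_{ii}=0$, $(R(q)X)_{ij}=X_{ij}\coth(q_i-q_j)$ for $i\ne j$. *)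

theory Defs
  imports "HOL-Analysis.Analysis"
begin

text \<open>Matrices in gl(n,C) are represented as complex^'n^'n; the index type 'n is
  finite and linearly ordered (playing the role of 1..n).\<close>

type_synonym 'n cmat = "complex^'n^'n"

definition adj :: "'n::finite cmat \<Rightarrow> 'n cmat" where
  "adj X = (\<chi> i j. cnj (X $ j $ i))"

definition ip :: "'n::finite cmat \<Rightarrow> 'n cmat \<Rightarrow> real" where
  "ip X Y = Re (trace (X ** Y))"

definition comm :: "'n::finite cmat \<Rightarrow> 'n cmat \<Rightarrow> 'n cmat" where
  "comm X Y = X ** Y - Y ** X"

definition ppart :: "'n::finite cmat \<Rightarrow> 'n cmat" where
  "ppart X = (1/2) *\<^sub>R (X - adj X)"

definition mpart :: "'n::finite cmat \<Rightarrow> 'n cmat" where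
  "mpart X = (1/2) *\<^sub>R (X + adj X)"

definition diag_part :: "'n::finite cmat \<Rightarrow> 'n cmat" where
  "diag_part X = (\<chi> i j. if i = j then X $ i $ j else 0)"

definition G0minus :: "'n::finite cmat set" where
  "G0minus = {X. adj X = X \<and> (\<forall>i j. i \<noteq> j \<longrightarrow> X $ i $ j = 0)}"

primrec matpow :: "'n::finite cmat \<Rightarrow> nat \<Rightarrow> 'n cmat" where
  "matpow X 0 = mat 1"
| "matpow X (Suc k) = X ** matpow X k"

definition mexp :: "'n::finite cmat \<Rightarrow> 'n cmat" where
  "mexp X = (\<Sum>k. (1 / fact k) *\<^sub>R matpow X k)"

definition GLn :: "'n::finite cmat set" where
  "GLn = {g. invertible g}"

definition MM :: "('n::finite cmat \<times> 'n cmat) set" where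
  "MM = GLn \<times> UNIV"

definition Ugrp :: "'n::finite cmat set" where
  "Ugrp = {\<eta>. \<eta> ** adj \<eta> = mat 1 \<and> adj \<eta> ** \<eta> = mat 1}"

text \<open>C-infinity on an open set: all iterated directional derivatives exist
  and are continuous.  D vs is the iterated directional derivative along the
  directions in the list vs (innermost derivative = last element).\<close>
definition smooth_on :: "'a::real_normed_vector set \<Rightarrow> ('a \<Rightarrow> real) \<Rightarrow> bool" where
  "smooth_on S f \<longleftrightarrow>
     (\<exists>D :: 'a list \<Rightarrow> 'a \<Rightarrow> real.
        (\<forall>x\<in>S. D [] x = f x) \<and>
        (\<forall>vs v x. x \<in> S \<longrightarrow>
            ((\<lambda>t. D vs (x + t *\<^sub>R v)) has_real_derivative D (v # vs) x) (at 0)) \<and>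
        (\<forall>vs. continuous_on S (D vs)))"

definition Cinf_inv :: "('n::finite cmat \<times> 'n cmat \<Rightarrow> real) set" where
  "Cinf_inv = {F. smooth_on MM F \<and>
     (\<forall>\<eta>\<in>Ugrp. \<forall>g J. (g, J) \<in> MM \<longrightarrow>
        F (g ** matrix_inv \<eta>, J) = F (g, J) \<and>
        F (\<eta> ** g, \<eta> ** J ** matrix_inv \<eta>) = F (g, J))}"

definition nabla1 :: "('n::finite cmat \<times> 'n cmat \<Rightarrow> real) \<Rightarrow> 'n cmat \<times> 'n cmat \<Rightarrow> 'n cmat" where
  "nabla1 F p = (THE Z. \<forall>X. ((\<lambda>t. F (mexp (t *\<^sub>R X) ** fst p, snd p))
                           has_real_derivative ip Z X) (at 0))"

definition d2 :: "('n::finite cmat \<times> 'n cmat \<Rightarrow> real) \<Rightarrow> 'n cmat \<times> 'n cmat \<Rightarrow> 'n cmat" where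
  "d2 F p = (THE Z. \<forall>X. ((\<lambda>t. F (fst p, snd p + t *\<^sub>R X))
                           has_real_derivative ip Z X) (at 0))"

definition PB1 :: "('n::finite cmat \<times> 'n cmat \<Rightarrow> real) \<Rightarrow> ('n cmat \<times> 'n cmat \<Rightarrow> real)
                    \<Rightarrow> 'n cmat \<times> 'n cmat \<Rightarrow> real" where
  "PB1 F H p = ip (nabla1 F p) (d2 H p) - ip (nabla1 H p) (d2 F p)
               + ip (snd p) (comm (d2 F p) (d2 H p))"

definition regq :: "'n::{finite,linorder} cmat \<Rightarrow> bool" where
  "regq q \<longleftrightarrow> q \<in> G0minus \<and> (\<forall>i j. i < j \<longrightarrow> Re (q $ j $ j) < Re (q $ i $ i))"

definition M0reg :: "('n::{finite,linorder} cmat \<times> 'n cmat) set" where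
  "M0reg = {(mexp q, J) | q J. regq q}"

text \<open>F o iota: the restriction of F to M_0^reg (extended by 0 elsewhere,
  which is irrelevant for everything below).\<close>
definition red :: "('n::{finite,linorder} cmat \<times> 'n cmat \<Rightarrow> real) \<Rightarrow> 'n cmat \<times> 'n cmat \<Rightarrow> real" where
  "red F = (\<lambda>p. if p \<in> M0reg then F p else 0)"

definition red_nabla1 :: "('n::finite cmat \<times> 'n cmat \<Rightarrow> real) \<Rightarrow> 'n cmat \<Rightarrow> 'n cmat \<Rightarrow> 'n cmat" where
  "red_nabla1 f q J = (THE Z. Z \<in> G0minus \<and>
     (\<forall>X0\<in>G0minus. ((\<lambda>t. f (mexp (q + t *\<^sub>R X0), J)) has_real_derivative ip Z X0) (at 0)))"

definition red_d2 :: "('n::finite cmat \<times> 'n cmat \<Rightarrow> real) \<Rightarrow> 'n cmat \<Rightarrow> 'n cmat \<Rightarrow> 'n cmat" where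
  "red_d2 f q J = (THE Z. \<forall>X. ((\<lambda>t. f (mexp q, J + t *\<^sub>R X)) has_real_derivative ip Z X) (at 0))"

definition coth :: "real \<Rightarrow> real" where
  "coth x = cosh x / sinh x"

definition Rop :: "'n::finite cmat \<Rightarrow> 'n cmat \<Rightarrow> 'n cmat" where
  "Rop q X = (\<chi> i j. if i = j then 0 else X $ i $ j * complex_of_real (coth (Re (q $ i $ i) - Re (q $ j $ j))))"

definition Hk :: "nat \<Rightarrow> 'n::finite cmat \<times> 'n cmat \<Rightarrow> real" where
  "Hk k p = Re (trace (matpow (snd p) k)) / real k"

definition Htk :: "nat \<Rightarrow> 'n::finite cmat \<times> 'n cmat \<Rightarrow> real" where
  "Htk k p = Im (trace (matpow (snd p) k)) / real k"

end

theory Submission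
  imports Defs
begin

text \<open>
  Write g for the exponential of q, A for the left gradient and B for the J-gradient of an invariant
  function F at (g, J). Differentiating the invariance along curves in U(n) gives two facts: left
  invariance says that A and [B, J] have the same anti-Hermitian part, and right invariance says that
  the conjugate of A by the inverse of g is Hermitian. Since g is diagonal, the second fact
  reads entrywise: exp(-x) (M + P) = exp(x) (M - P) with x = q_i - q_j, where M and P are the
  (i,j)-entries of the Hermitian and anti-Hermitian parts of A; hence M = coth(x) P off the diagonal.
  So A is the reduced gradient plus R(q) [B, J]^+ plus [B, J]^+, and inserting this into the bracket
  leaves only the invariance of the trace form. For the functions of J alone that are traces of powers,
  A vanishes and B commutes with J; the antisymmetry of R(q) then gives the second formula.
\<close>

section \<open>Differentiability of smooth functions\<close>

text \<open>The classical argument: pass from x to x + h one basis coordinate at a time and control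
  each move by the mean value theorem and continuity of the partial derivative at x. The resulting
  Frechet derivative supplies the chain rule along arbitrary curves.\<close>

lemma has_derivative_continuous_directional_derivatives:
  fixes f :: "'a::euclidean_space \<Rightarrow> real"
  assumes "open S" "x \<in> S"
    and deriv: "\<And>y v. y \<in> S \<Longrightarrow> ((\<lambda>t. f (y + t *\<^sub>R v)) has_real_derivative D v y) (at 0)"
    and cont: "\<And>v. continuous_on S (D v)"
  shows "(f has_derivative (\<lambda>h. \<Sum>b\<in>Basis. (h \<bullet> b) * D b x)) (at x)"
proof -
  \<comment> \<open>\<open>part A h\<close> keeps only the coordinates of h in A; the induction on A
    reaches h itself at A = \<open>Basis\<close>.\<close>
  define part where "part A h = (\<Sum>b\<in>A. (h \<bullet> b) *\<^sub>R b)" for A and h :: 'a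
  have line: "((\<lambda>t. f (y + (t * s) *\<^sub>R b)) has_real_derivative D b (y + (t * s) *\<^sub>R b) * s) (at t)"
    if "y + (t * s) *\<^sub>R b \<in> S" for y b s t
  proof -
    let ?z = "y + (t * s) *\<^sub>R b"
    have 1: "((\<lambda>u. f (?z + u *\<^sub>R b)) has_real_derivative D b ?z) (at ((t - t) * s))"
      using deriv[OF that] by simp
    have 2: "((\<lambda>u. (u - t) * s) has_real_derivative s) (at t)"
      by (auto intro!: derivative_eq_intros)
    have "((\<lambda>u. f (?z + ((u - t) * s) *\<^sub>R b)) has_real_derivative D b ?z * s) (at t)"
      by (rule DERIV_chain2[OF 1 2])
    moreover have "?z + ((u - t) * s) *\<^sub>R b = y + (u * s) *\<^sub>R b" for u
      by (simp add: algebra_simps)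
    ultimately show ?thesis by simp
  qed
  have "\<forall>e>0. \<exists>d>0. \<forall>h. norm h < d \<longrightarrow>
      \<bar>f (x + part A h) - f x - (\<Sum>b\<in>A. (h \<bullet> b) * D b x)\<bar> \<le> e * norm h"
    if "finite A" "A \<subseteq> Basis" for A
    using that
  proof (induction A rule: finite_induct)
    case empty
    then show ?case by (auto simp: part_def intro!: exI[of _ 1])
  next
    case (insert b A)
    show ?case
    proof (intro allI impI)
      fix e :: real assume e: "e > 0"
      obtain d1 where d1: "d1 > 0" and d1': "\<And>h. norm h < d1 \<Longrightarrow>
          \<bar>f (x + part A h) - f x - (\<Sum>b\<in>A. (h \<bullet> b) * D b x)\<bar> \<le> e / 2 * norm h"
        using insert.IH insert.prems e by (metis half_gt_zero insert_subset)
      have "isCont (D b) x"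
        using cont \<open>open S\<close> \<open>x \<in> S\<close> continuous_on_eq_continuous_at by blast
      then obtain d2 where d2: "d2 > 0" and d2': "\<And>y. dist y x < d2 \<Longrightarrow> dist (D b y) (D b x) < e / 2"
        using e unfolding continuous_at_eps_delta by (metis half_gt_zero)
      obtain d3 where d3: "d3 > 0" and d3': "ball x d3 \<subseteq> S"
        using \<open>open S\<close> \<open>x \<in> S\<close> openE by blast
      define r where "r = min d2 d3"
      \<comment> \<open>Each coordinate in A, and the one moved now, shifts the point by at most
        \<open>norm h\<close>, so the whole segment stays within \<open>N * norm h\<close> of
        x.\<close>
      define N where "N = real (card A) + 1"
      have N: "N > 0" by (simp add: N_def)
      have r: "r > 0" using d2 d3 by (simp add: r_def)
      show "\<exists>d>0. \<forall>h. norm h < d \<longrightarrow>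
        \<bar>f (x + part (insert b A) h) - f x - (\<Sum>b\<in>insert b A. (h \<bullet> b) * D b x)\<bar> \<le> e * norm h"
      proof (intro exI[of _ "min d1 (r / N)"] conjI allI impI)
        show "0 < min d1 (r / N)" using d1 r N by simp
        fix h :: 'a assume h: "norm h < min d1 (r / N)"
        define s where "s = h \<bullet> b"
        define y where "y = x + part A h"
        have b: "b \<in> Basis" using insert.prems by simp
        have s: "\<bar>s\<bar> \<le> norm h" unfolding s_def using b by (rule Basis_le_norm)
        have "norm (part A h) \<le> (\<Sum>b\<in>A. norm ((h \<bullet> b) *\<^sub>R b))"
          unfolding part_def by (rule norm_sum)
        also have "\<dots> \<le> (\<Sum>b\<in>A. norm h)"
          using insert.prems by (intro sum_mono) (auto simp: Basis_le_norm subset_iff)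
        finally have pA: "norm (part A h) \<le> real (card A) * norm h" by simp
        have near: "dist (y + (t * s) *\<^sub>R b) x < r" if "0 \<le> t" "t \<le> 1" for t
        proof -
          have "dist (y + (t * s) *\<^sub>R b) x = norm (part A h + (t * s) *\<^sub>R b)"
            by (simp add: y_def dist_norm)
          also have "\<dots> \<le> norm (part A h) + norm ((t * s) *\<^sub>R b)" by (rule norm_triangle_ineq)
          also have "norm ((t * s) *\<^sub>R b) \<le> 1 * norm h"
            using that b s mult_mono[of t 1 "\<bar>s\<bar>" "norm h"] by (simp add: abs_mult)
          also have "norm (part A h) + 1 * norm h \<le> N * norm h"
            using pA by (simp add: N_def algebra_simps)
          also have "\<dots> < r" using h N by (simp add: field_simps)
          finally show ?thesis by simp
        qed
        \<comment> \<open>Running t over [0, 1] with velocity s treats every sign of s, and s = 0,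
          at once.\<close>
        have "\<exists>t>0. t < 1 \<and> f (y + (1 * s) *\<^sub>R b) - f (y + (0 * s) *\<^sub>R b)
            = (1 - 0) * (D b (y + (t * s) *\<^sub>R b) * s)"
        proof (rule MVT2)
          fix t :: real assume "0 \<le> t" "t \<le> 1"
          then have "y + (t * s) *\<^sub>R b \<in> S"
            using near d3' by (force simp: r_def mem_ball dist_commute)
          then show "((\<lambda>t. f (y + (t * s) *\<^sub>R b)) has_real_derivative D b (y + (t * s) *\<^sub>R b) * s) (at t)"
            by (rule line)
        qed simp
        then obtain t where t: "0 < t" "t < 1"
          "f (y + s *\<^sub>R b) - f y = D b (y + (t * s) *\<^sub>R b) * s" by auto
        have "dist (D b (y + (t * s) *\<^sub>R b)) (D b x) < e / 2"
          using near[of t] t by (intro d2') (simp add: r_def)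
        then have "\<bar>(D b (y + (t * s) *\<^sub>R b) - D b x) * s\<bar> \<le> e / 2 * norm h"
          unfolding abs_mult using s e by (intro mult_mono) (auto simp: dist_real_def)
        then have "\<bar>f (y + s *\<^sub>R b) - f y - s * D b x\<bar> \<le> e / 2 * norm h"
          using t(3) by (simp add: algebra_simps)
        moreover have "\<bar>f y - f x - (\<Sum>b\<in>A. (h \<bullet> b) * D b x)\<bar> \<le> e / 2 * norm h"
          using d1' h by (simp add: y_def)
        ultimately have "\<bar>f (y + s *\<^sub>R b) - f x - (s * D b x + (\<Sum>b\<in>A. (h \<bullet> b) * D b x))\<bar>
            \<le> e / 2 * norm h + e / 2 * norm h" by linarith
        also have "e / 2 * norm h + e / 2 * norm h = e * norm h" by simp
        finally show "\<bar>f (x + part (insert b A) h) - f x - (\<Sum>b\<in>insert b A. (h \<bullet> b) * D b x)\<bar>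
            \<le> e * norm h"
          using insert.hyps by (simp add: part_def y_def s_def ac_simps)
      qed
    qed
  qed
  from this[OF finite_Basis order_refl]
  have small: "\<forall>e>0. \<exists>d>0. \<forall>h. norm h < d \<longrightarrow>
      \<bar>f (x + h) - f x - (\<Sum>b\<in>Basis. (h \<bullet> b) * D b x)\<bar> \<le> e * norm h"
    by (simp add: part_def euclidean_representation)
  have "\<forall>e>0. \<exists>d>0. \<forall>y. norm (y - x) < d \<longrightarrow>
      norm (f y - f x - (\<Sum>b\<in>Basis. ((y - x) \<bullet> b) * D b x)) \<le> e * norm (y - x)"
  proof (intro allI impI)
    fix e :: real assume "e > 0"
    then obtain d where "d > 0" and d: "\<And>h. norm h < d \<Longrightarrow>
      \<bar>f (x + h) - f x - (\<Sum>b\<in>Basis. (h \<bullet> b) * D b x)\<bar> \<le> e * norm h"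
      using small by metis
    show "\<exists>d>0. \<forall>y. norm (y - x) < d \<longrightarrow>
      norm (f y - f x - (\<Sum>b\<in>Basis. ((y - x) \<bullet> b) * D b x)) \<le> e * norm (y - x)"
      using \<open>d > 0\<close> d[of "_ - x"] by (intro exI[of _ d]) simp
  qed
  moreover have "bounded_linear (\<lambda>h. \<Sum>b\<in>Basis. (h \<bullet> b) * D b x)"
    by (intro bounded_linear_sum bounded_linear_mult_const bounded_linear_inner_left)
  ultimately show ?thesis
    unfolding has_derivative_at_alt by blast
qed

lemma smooth_on_imp_has_derivative:
  fixes f :: "'a::euclidean_space \<Rightarrow> real"
  assumes "smooth_on S f" "open S" "x \<in> S"
  obtains f' where "(f has_derivative f') (at x)"
proof -
  obtain D where D0: "\<And>x. x \<in> S \<Longrightarrow> D [] x = f x"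
    and D: "\<And>vs v x. x \<in> S \<Longrightarrow> ((\<lambda>t. D vs (x + t *\<^sub>R v)) has_real_derivative D (v # vs) x) (at 0)"
    and C: "\<And>vs. continuous_on S (D vs)"
    using assms(1) unfolding smooth_on_def by blast
  have "(D [] has_derivative (\<lambda>h. \<Sum>b\<in>Basis. (h \<bullet> b) * D [b] x)) (at x)"
    using has_derivative_continuous_directional_derivatives[of S x "D []" "\<lambda>v. D [v]"] assms D C by blast
  then have "(f has_derivative (\<lambda>h. \<Sum>b\<in>Basis. (h \<bullet> b) * D [b] x)) (at x)"
    by (rule has_derivative_transform_within_open[OF _ assms(2,3)]) (simp add: D0)
  then show ?thesis by (rule that)
qed

lemma has_vector_derivative_vec:
  fixes f :: "real \<Rightarrow> 'a::real_normed_vector^'n"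
  assumes "\<And>i. ((\<lambda>t. f t $ i) has_vector_derivative v $ i) (at x)"
  shows "(f has_vector_derivative v) (at x)"
proof -
  have "((\<lambda>y. (f y - f x - (y - x) *\<^sub>R v) /\<^sub>R norm (y - x)) \<longlongrightarrow> 0) (at x)"
    using assms unfolding has_vector_derivative_def has_derivative_at_within
    by (intro vec_tendstoI) simp
  then show ?thesis
    unfolding has_vector_derivative_def has_derivative_at_within
    by (simp add: bounded_linear_scaleR_left)
qed

section \<open>Complex matrices\<close>

lemma bounded_bilinear_matrix_mult:
  "bounded_bilinear ((**) :: complex^'n^'n \<Rightarrow> complex^'n^'n \<Rightarrow> complex^'n^'n)"
  unfolding bilinear_conv_bounded_bilinear[symmetric] bilinear_def
  by (auto intro!: linearI simp: matrix_matrix_mult_def vec_eq_iff sum.distrib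
      distrib_left distrib_right scaleR_right.sum)

interpretation matrix_mult: bounded_bilinear
  "(**) :: complex^'n^'n \<Rightarrow> complex^'n^'n \<Rightarrow> complex^'n^'n"
  by (rule bounded_bilinear_matrix_mult)

lemma bounded_linear_adj: "bounded_linear (adj :: 'n::finite cmat \<Rightarrow> _)"
  unfolding linear_conv_bounded_linear[symmetric]
  by (auto intro!: linearI simp: adj_def vec_eq_iff)

lemma adj_linear:
  "adj (X + Y) = adj X + adj Y" "adj (X - Y) = adj X - adj Y" "adj (- X) = - adj X"
  "adj (r *\<^sub>R X) = r *\<^sub>R adj X"
  by (simp_all add: adj_def vec_eq_iff)

lemma adj_adj [simp]: "adj (adj X) = X"
  by (simp add: adj_def vec_eq_iff)

lemma adj_mult: "adj (X ** Y) = adj Y ** adj X"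
  by (simp add: adj_def vec_eq_iff matrix_matrix_mult_def mult.commute)

lemma adj_mat_1 [simp]: "adj (mat 1) = mat 1"
  by (simp add: adj_def vec_eq_iff mat_def)

lemma continuous_on_det: "continuous_on UNIV (det :: complex^'n^'n \<Rightarrow> complex)"
  unfolding det_def by (intro continuous_intros)

lemma open_GLn: "open (GLn :: 'n::finite cmat set)"
proof -
  have "GLn = (det :: 'n cmat \<Rightarrow> complex) -` (- {0})"
    by (auto simp: GLn_def invertible_det_nz)
  then show ?thesis
    using continuous_on_det open_vimage[of "- {0}"] by (metis open_Compl closed_singleton)
qed

lemma open_MM: "open (MM :: ('n::finite cmat \<times> 'n cmat) set)"
  unfolding MM_def by (intro open_Times open_GLn open_UNIV)

section \<open>The matrix exponential\<close>

lemma matpow_scaleR: "matpow (t *\<^sub>R X) k = t ^ k *\<^sub>R matpow X k"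
  by (induction k) (simp_all add: matrix_mult.scaleR_left matrix_mult.scaleR_right)

text \<open>Domination by the exponential series of \<open>norm X * K\<close>, where K is the
  constant in the norm bound for matrix products.\<close>

lemma summable_mexp: "summable (\<lambda>k. (1 / fact k) *\<^sub>R matpow (X :: 'n::finite cmat) k)"
proof -
  obtain K where K: "\<And>(A :: 'n cmat) B :: 'n cmat. norm (A ** B) \<le> norm A * norm B * K" "K > 0"
    using bounded_bilinear.pos_bounded[OF bounded_bilinear_matrix_mult[where 'n='n]] by metis
  have bound: "norm (matpow X k) \<le> norm (mat 1 :: 'n cmat) * (norm X * K) ^ k" for k
  proof (induction k)
    case (Suc k)
    have "norm (matpow X (Suc k)) \<le> norm X * norm (matpow X k) * K"
      using K(1) by simp
    also have "\<dots> \<le> norm X * (norm (mat 1 :: 'n cmat) * (norm X * K) ^ k) * K"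
      using Suc.IH K(2) by (intro mult_right_mono mult_left_mono) auto
    finally show ?case by (simp add: algebra_simps)
  qed simp
  have "summable (\<lambda>k. norm (mat 1 :: 'n cmat) * ((norm X * K) ^ k /\<^sub>R fact k))"
    by (intro summable_mult summable_exp_generic)
  then show ?thesis
  proof (rule summable_comparison_test')
    show "norm ((1 / fact k) *\<^sub>R matpow X k) \<le> norm (mat 1 :: 'n cmat) * ((norm X * K) ^ k /\<^sub>R fact k)" for k
      using bound[of k] by (simp add: field_simps)
  qed
qed

lemma mexp_nth_sums: "(\<lambda>k. matpow X k $ i $ j / fact k) sums (mexp X $ i $ j)"
proof -
  have "(\<lambda>k. (1 / fact k) *\<^sub>R matpow X k) sums mexp X"
    unfolding mexp_def by (rule summable_sums[OF summable_mexp])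
  then have "(\<lambda>k. ((1 / fact k) *\<^sub>R matpow X k) $ i $ j) sums (mexp X $ i $ j)"
    by (intro bounded_linear.sums[OF bounded_linear_vec_nth])
  then show ?thesis by (simp add: scaleR_conv_of_real[where 'a=complex] field_simps)
qed

lemma mexp_0 [simp]: "mexp (0 :: 'a::finite cmat) = mat 1"
proof -
  have "(\<lambda>k. (1 / fact k) *\<^sub>R matpow (0 :: 'a cmat) k) = (\<lambda>k. if k = 0 then mat 1 else 0)"
    by (auto simp: fun_eq_iff gr0_conv_Suc matrix_mult.zero_left)
  moreover have "(\<lambda>k. if k = 0 then mat 1 else 0) sums (mat 1 :: 'a cmat)"
    by (rule sums_single)
  ultimately show ?thesis
    unfolding mexp_def by (simp add: sums_unique[symmetric])
qed

text \<open>Each entry is an everywhere convergent power series in t, and its derivative at 0 is the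
  coefficient of t, an entry of X.\<close>

lemma has_vector_derivative_mexp:
  "((\<lambda>t. mexp (t *\<^sub>R X)) has_vector_derivative X) (at 0)"
proof (intro has_vector_derivative_vec)
  fix i j
  define c where "c k = matpow X k $ i $ j / fact k" for k
  have sums: "(\<lambda>k. c k * of_real t ^ k) sums (mexp (t *\<^sub>R X) $ i $ j)" for t
  proof -
    have "(\<lambda>k. matpow (t *\<^sub>R X) k $ i $ j / fact k) = (\<lambda>k. c k * of_real t ^ k)"
      by (simp add: c_def matpow_scaleR fun_eq_iff scaleR_conv_of_real[where 'a=complex])
    with mexp_nth_sums[of "t *\<^sub>R X" i j] show ?thesis by simp
  qed
  \<comment> \<open>Convergence is known at real points; the real point \<open>norm z + 1\<close>
    forces it at the complex point z.\<close>
  have "summable (\<lambda>k. c k * z ^ k)" for z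
  proof (rule powser_inside)
    show "summable (\<lambda>k. c k * of_real (norm z + 1) ^ k)"
      using sums by (rule sums_summable)
    show "norm z < norm (of_real (norm z + 1) :: complex)" by (simp only: norm_of_real)
  qed
  from termdiffs_strong_converges_everywhere[of c 0, OF this]
  have "((\<lambda>z. \<Sum>k. c k * z ^ k) has_field_derivative (\<Sum>k. diffs c k * 0 ^ k)) (at (of_real 0))"
    by simp
  then have "((\<lambda>t. \<Sum>k. c k * of_real t ^ k) has_vector_derivative (\<Sum>k. diffs c k * 0 ^ k)) (at 0)"
    by (rule has_vector_derivative_real_field)
  moreover have "(\<Sum>k. diffs c k * 0 ^ k) = X $ i $ j"
    by (simp add: diffs_def c_def)
  moreover have "(\<Sum>k. c k * of_real t ^ k) = mexp (t *\<^sub>R X) $ i $ j" for t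
    using sums_unique[OF sums] by simp
  ultimately show "((\<lambda>t. mexp (t *\<^sub>R X) $ i $ j) has_vector_derivative X $ i $ j) (at 0)"
    by simp
qed

lemma mexp_diagonal:
  assumes "\<And>i j. i \<noteq> j \<Longrightarrow> q $ i $ j = 0"
  shows "mexp q $ i $ j = (if i = j then exp (q $ i $ i) else 0)"
proof -
  have "matpow q k $ i $ j = (if i = j then (q $ i $ i) ^ k else 0)" for k i j
  proof (induction k arbitrary: i j)
    case (Suc k)
    have "matpow q (Suc k) $ i $ j = (\<Sum>l\<in>UNIV. q $ i $ l * (if l = j then (q $ l $ l) ^ k else 0))"
      using Suc.IH by (simp add: matrix_matrix_mult_def)
    also have "\<dots> = (\<Sum>l\<in>UNIV. if l = j then q $ i $ j * (q $ j $ j) ^ k else 0)"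
      by (intro sum.cong) auto
    finally show ?case using assms by auto
  qed (simp add: mat_def)
  then have "(\<lambda>k. matpow q k $ i $ j / fact k) = (\<lambda>k. if i = j then (q $ i $ i) ^ k /\<^sub>R fact k else 0)"
    by (simp add: fun_eq_iff scaleR_conv_of_real[where 'a=complex] field_simps)
  moreover have "(\<lambda>k. if i = j then (q $ i $ i) ^ k /\<^sub>R fact k else 0) sums (if i = j then exp (q $ i $ i) else 0)"
    using exp_converges by auto
  ultimately show ?thesis
    by (intro sums_unique2[OF mexp_nth_sums[of q i j]]) simp
qed

section \<open>The trace form\<close>

text \<open>The Euclidean inner product of complex matrices is Re tr(X* Y), so the indefinite trace
  form differs from it only by \<open>adj\<close> in one slot. Nondegeneracy and the representation
  of functionals are inherited this way.\<close>

lemma ip_eq_inner: "ip X Y = adj X \<bullet> Y"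
proof -
  have "ip X Y = (\<Sum>i\<in>UNIV. \<Sum>k\<in>UNIV. Re (X $ i $ k * Y $ k $ i))"
    by (simp add: ip_def trace_def matrix_matrix_mult_def)
  also have "\<dots> = (\<Sum>k\<in>UNIV. \<Sum>i\<in>UNIV. Re (X $ i $ k * Y $ k $ i))"
    by (rule sum.swap)
  also have "\<dots> = adj X \<bullet> Y"
    by (simp add: inner_vec_def adj_def inner_complex_def)
  finally show ?thesis .
qed

lemma ip_commute: "ip X Y = ip Y X"
  by (simp only: ip_def trace_mul_sym[of X Y])

lemma ip_linear:
  "ip (X + Y) Z = ip X Z + ip Y Z" "ip (X - Y) Z = ip X Z - ip Y Z"
  "ip Z (X + Y) = ip Z X + ip Z Y" "ip Z (X - Y) = ip Z X - ip Z Y"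
  "ip (- X) Z = - ip X Z" "ip Z (- X) = - ip Z X"
  "ip (r *\<^sub>R X) Z = r * ip X Z" "ip Z (r *\<^sub>R X) = r * ip Z X"
  by (simp_all add: ip_eq_inner adj_linear inner_simps)

lemma ip_0 [simp]: "ip 0 X = 0"
  by (simp add: ip_def matrix_mult.zero_left trace_def)

lemma ip_adj_adj: "ip (adj X) (adj Y) = ip X Y"
proof -
  have "ip (adj X) (adj Y) = adj Y \<bullet> X" by (simp add: ip_eq_inner inner_commute)
  also have "\<dots> = ip X Y" by (simp add: ip_eq_inner[symmetric] ip_commute)
  finally show ?thesis .
qed

lemma ip_eqI: "(\<And>X. ip Z X = ip W X) \<Longrightarrow> Z = W"
  by (metis adj_adj ip_eq_inner vector_eq_rdot)

lemma ip_representation: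
  assumes "linear L"
  obtains Z where "\<And>X :: 'n::finite cmat. L X = ip Z X"
proof
  fix X :: "'n cmat"
  have "L X = L (\<Sum>b\<in>Basis. (X \<bullet> b) *\<^sub>R b)" by (simp add: euclidean_representation)
  also have "\<dots> = (\<Sum>b\<in>Basis. (X \<bullet> b) * L b)"
    using assms by (simp add: linear_sum linear_scale)
  also have "\<dots> = ip (adj (\<Sum>b\<in>Basis. L b *\<^sub>R b)) X"
    by (simp add: ip_eq_inner inner_sum_left inner_commute[of X] mult.commute)
  finally show "L X = ip (adj (\<Sum>b\<in>Basis. L b *\<^sub>R b)) X" .
qed

lemma comm_linear:
  "comm (X + Y) Z = comm X Z + comm Y Z" "comm (X - Y) Z = comm X Z - comm Y Z"
  "comm Z (X + Y) = comm Z X + comm Z Y" "comm Z (X - Y) = comm Z X - comm Z Y"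
  by (simp_all add: comm_def matrix_mult.add_left matrix_mult.add_right
      matrix_mult.diff_left matrix_mult.diff_right)

lemma comm_swap: "comm X Y = - comm Y X"
  by (simp add: comm_def)

lemma ip_comm_cyclic: "ip (comm X Y) Z = ip X (comm Y Z)"
proof -
  have "trace (Y ** X ** Z) = trace (X ** (Z ** Y))"
    by (metis matrix_mul_assoc trace_mul_sym)
  then show ?thesis
    by (simp add: ip_def comm_def matrix_mult.diff_left matrix_mult.diff_right trace_sub matrix_mul_assoc)
qed

lemma ppart_plus_mpart: "X = ppart X + mpart X"
  by (simp add: ppart_def mpart_def algebra_simps scaleR_2[symmetric])

lemma adj_ppart: "adj (ppart X) = - ppart X"
  by (simp add: ppart_def adj_linear algebra_simps)

lemma adj_mpart: "adj (mpart X) = mpart X"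
  by (simp add: mpart_def adj_linear algebra_simps)

lemma ppart_eq_self: "adj X = - X \<Longrightarrow> ppart X = X"
  by (simp add: ppart_def scaleR_2[symmetric])

text \<open>\<open>adj\<close> is an involution preserving the form, so the projection onto its -1
  eigenspace is self-adjoint.\<close>

lemma ip_ppart: "ip (ppart X) Y = ip X (ppart Y)"
  using ip_adj_adj[of X "adj Y"] by (simp add: ppart_def ip_linear)

lemma ip_mpart: "ip (mpart X) Y = ip X (mpart Y)"
  using ip_adj_adj[of X "adj Y"] by (simp add: mpart_def ip_linear)

text \<open>Unitary invariance supplies only anti-Hermitian test directions; by self-adjointness of
  \<open>ppart\<close> and nondegeneracy they determine the anti-Hermitian part.\<close>

lemma ppart_eqI:
  assumes "\<And>Y. adj Y = - Y \<Longrightarrow> ip A Y = ip B Y"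
  shows "ppart A = ppart B"
  by (rule ip_eqI) (simp add: ip_ppart assms adj_ppart)

section \<open>Gradients with respect to the trace form\<close>

lemma has_real_derivative_along_curve:
  fixes f :: "'a::real_normed_vector \<Rightarrow> real"
  assumes "(f has_derivative f') (at p)" "(c has_vector_derivative v) (at 0)" "c 0 = p"
  shows "((\<lambda>t. f (c t)) has_real_derivative f' v) (at 0)"
proof -
  have "((\<lambda>t. f (c t)) has_derivative (\<lambda>t. f' (t *\<^sub>R v))) (at 0)"
    using has_derivative_compose[of c "\<lambda>t. t *\<^sub>R v" 0 UNIV f f'] assms
    by (simp add: has_vector_derivative_def)
  moreover have "f' (t *\<^sub>R v) = f' v * t" for t
    using has_derivative_linear[OF assms(1)] by (simp add: linear_scale)
  ultimately show ?thesis
    by (simp add: has_field_derivative_def)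
qed

text \<open>Nondegeneracy gives the uniqueness that the definite description asks for; existence
  comes from \<open>ip_representation\<close> in \<open>ip_d2\<close>.\<close>

lemma d2_eqI:
  assumes "\<And>X. ((\<lambda>t. F (g, J + t *\<^sub>R X)) has_real_derivative ip Z X) (at 0)"
  shows "d2 F (g, J) = Z"
  unfolding d2_def
proof (rule the_equality)
  show "W = Z" if "\<forall>X. ((\<lambda>t. F (fst (g, J), snd (g, J) + t *\<^sub>R X)) has_real_derivative ip W X) (at 0)" for W
    using that assms by (intro ip_eqI) (auto intro: DERIV_unique)
qed (simp add: assms)

lemma nabla1_eqI:
  assumes "\<And>X. ((\<lambda>t. F (mexp (t *\<^sub>R X) ** g, J)) has_real_derivative ip Z X) (at 0)"
  shows "nabla1 F (g, J) = Z"
  unfolding nabla1_def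
proof (rule the_equality)
  show "W = Z" if "\<forall>X. ((\<lambda>t. F (mexp (t *\<^sub>R X) ** fst (g, J), snd (g, J))) has_real_derivative ip W X) (at 0)" for W
    using that assms by (intro ip_eqI) (auto intro: DERIV_unique)
qed (simp add: assms)

lemma ip_d2:
  assumes F: "(F has_derivative F') (at (g, J))"
  shows "ip (d2 F (g, J)) X = F' (0, X)"
proof -
  have "linear (\<lambda>X. F' (0, X))"
    using linear_compose[OF _ has_derivative_linear[OF F], of "\<lambda>X. (0, X)"]
    by (simp add: o_def linear_iff)
  then obtain Z where Z: "\<And>X. F' (0, X) = ip Z X" by (rule ip_representation) blast
  have "d2 F (g, J) = Z"
  proof (rule d2_eqI)
    fix X :: "'a cmat"
    have "((\<lambda>t. (g, J + t *\<^sub>R X)) has_vector_derivative (0, X)) (at 0)"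
      by (auto intro!: derivative_eq_intros has_vector_derivative_Pair)
    from has_real_derivative_along_curve[OF F this]
    show "((\<lambda>t. F (g, J + t *\<^sub>R X)) has_real_derivative ip Z X) (at 0)" by (simp add: Z)
  qed
  then show ?thesis by (simp add: Z)
qed

text \<open>The curve exp(tX) g has initial velocity X g, and the resulting functional of X is
  represented by a matrix.\<close>

lemma ip_nabla1:
  assumes F: "(F has_derivative F') (at (g, J))"
  shows "ip (nabla1 F (g, J)) X = F' (X ** g, 0)"
proof -
  have "linear (\<lambda>X. F' (X ** g, 0))"
    using linear_compose[OF _ has_derivative_linear[OF F], of "\<lambda>X. (X ** g, 0)"]
    by (simp add: o_def linear_iff matrix_mult.add_left matrix_mult.scaleR_left)
  then obtain Z where Z: "\<And>X. F' (X ** g, 0) = ip Z X" by (rule ip_representation) blast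
  have "nabla1 F (g, J) = Z"
  proof (rule nabla1_eqI)
    fix X :: "'a cmat"
    have "((\<lambda>t. mexp (t *\<^sub>R X) ** g) has_vector_derivative X ** g) (at 0)"
      by (rule bounded_linear.has_vector_derivative[OF matrix_mult.bounded_linear_left has_vector_derivative_mexp])
    then have "((\<lambda>t. (mexp (t *\<^sub>R X) ** g, J)) has_vector_derivative (X ** g, 0)) (at 0)"
      by (intro has_vector_derivative_Pair has_vector_derivative_const)
    from has_real_derivative_along_curve[OF F this]
    show "((\<lambda>t. F (mexp (t *\<^sub>R X) ** g, J)) has_real_derivative ip Z X) (at 0)" by (simp add: Z)
  qed
  then show ?thesis by (simp add: Z)
qed

section \<open>Curves in the unitary group\<close>

lemma matrix_inv_unique:
  fixes A :: "'n::finite cmat"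
  assumes "A ** B = mat 1" "B ** A = mat 1"
  shows "matrix_inv A = B"
  unfolding matrix_inv_def
proof (rule some_equality)
  show "C = B" if "A ** C = mat 1 \<and> C ** A = mat 1" for C
    by (metis assms(1) that matrix_mul_assoc matrix_mul_lid matrix_mul_rid)
qed (use assms in simp)

lemma matrix_inv_inverse:
  assumes "invertible A"
  shows "A ** matrix_inv A = mat 1" "matrix_inv A ** A = mat 1"
  using someI_ex[OF assms[unfolded invertible_def]] by (simp_all add: matrix_inv_def)

lemma matrix_inv_Ugrp: "\<eta> \<in> Ugrp \<Longrightarrow> matrix_inv \<eta> = adj \<eta>"
  by (rule matrix_inv_unique) (auto simp: Ugrp_def)

text \<open>A uniform bound on U(n), used to control the Cayley curve before its continuity is
  known.\<close>

lemma norm_Ugrp: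
  assumes "\<eta> \<in> (Ugrp :: 'n::finite cmat set)"
  shows "norm \<eta> = sqrt (real CARD('n))"
proof -
  have "\<eta> \<bullet> \<eta> = ip (adj \<eta>) \<eta>" by (simp add: ip_eq_inner)
  also have "\<dots> = real CARD('n)" using assms by (simp add: ip_def Ugrp_def trace_I)
  finally show ?thesis by (simp add: norm_eq_sqrt_inner)
qed

text \<open>\<open>adj\<close> interchanges 1 - S and 1 + S, and these commute, so the product with
  the adjoint collapses to 1.\<close>

lemma cayley_in_Ugrp:
  fixes S :: "'n::finite cmat"
  assumes "adj S = - S" "invertible (mat 1 - S)"
  shows "matrix_inv (mat 1 - S) ** (mat 1 + S) \<in> Ugrp"
proof -
  define M N where "M = mat 1 - S" and "N = mat 1 + S"
  define M' where "M' = matrix_inv M"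
  have MM': "M ** M' = mat 1" "M' ** M = mat 1"
    using matrix_inv_inverse[OF assms(2)] unfolding M_def M'_def by simp_all
  have adj: "adj M = N" "adj N = M"
    using assms(1) by (simp_all add: M_def N_def adj_linear)
  have com: "M ** N = N ** M"
    by (simp add: M_def N_def matrix_mult.add_left matrix_mult.add_right
        matrix_mult.diff_left matrix_mult.diff_right)
  have NN': "N ** adj M' = mat 1"
    using MM' adj by (metis adj_mat_1 adj_mult)
  have "(M' ** N) ** adj (M' ** N) = M' ** (N ** M) ** adj M'"
    by (simp add: adj_mult adj matrix_mul_assoc)
  also have "\<dots> = (M' ** M) ** (N ** adj M')"
    by (simp add: com[symmetric] matrix_mul_assoc)
  finally have 1: "(M' ** N) ** adj (M' ** N) = mat 1"
    using MM' NN' by simp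
  then have 2: "adj (M' ** N) ** (M' ** N) = mat 1"
    by (simp only: matrix_left_right_inverse)
  show ?thesis using 1 2 unfolding M'_def M_def N_def by (simp add: Ugrp_def)
qed

text \<open>The Cayley transform of t Y / 2 is used instead of the exponential: its unitarity is pure algebra,
  and its derivative can be read off the fixed point equation in the proof.\<close>

lemma unitary_curve:
  fixes Y :: "'n::finite cmat"
  assumes "adj Y = - Y"
  obtains \<eta> where "\<forall>\<^sub>F t in nhds 0. \<eta> t \<in> Ugrp" "\<eta> 0 = mat 1" "(\<eta> has_vector_derivative Y) (at 0)"
proof
  \<comment> \<open>The factor 1/2 is there because the numerator and the inverted denominator each
    contribute half of the velocity.\<close>
  define S where "S t = (t / 2) *\<^sub>R Y" for t :: real
  define \<eta> where "\<eta> t = matrix_inv (mat 1 - S t) ** (mat 1 + S t)" for t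
  show \<eta>0: "\<eta> 0 = mat 1"
    by (simp add: \<eta>_def S_def matrix_inv_unique)
  have "((\<lambda>t. mat 1 - S t) \<longlongrightarrow> mat 1 - S 0) (nhds 0)"
    unfolding S_def by (intro tendsto_intros filterlim_ident) auto
  moreover have "mat 1 - S 0 \<in> GLn"
    by (auto simp: S_def GLn_def invertible_def intro!: exI[of _ "mat 1"])
  ultimately have inv: "\<forall>\<^sub>F t in nhds 0. mat 1 - S t \<in> GLn"
    using open_GLn topological_tendstoD by blast
  from inv show U: "\<forall>\<^sub>F t in nhds 0. \<eta> t \<in> Ugrp"
    unfolding \<eta>_def
    by eventually_elim (auto simp: GLn_def S_def adj_linear assms intro!: cayley_in_Ugrp)
  \<comment> \<open>Clearing the denominator avoids differentiating the matrix inverse.\<close>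
  have eq: "\<eta> t = mat 1 + S t ** (mat 1 + \<eta> t)" if "mat 1 - S t \<in> GLn" for t
  proof -
    have "(mat 1 - S t) ** matrix_inv (mat 1 - S t) = mat 1"
      using that by (simp add: GLn_def matrix_inv_inverse)
    then have "(mat 1 - S t) ** \<eta> t = mat 1 + S t"
      by (simp add: \<eta>_def matrix_mul_assoc)
    then show ?thesis
      by (simp add: matrix_mult.diff_left matrix_mult.add_right algebra_simps)
  qed
  obtain K where K: "K > 0" "\<And>(A :: 'n cmat) B :: 'n cmat. norm (A ** B) \<le> norm A * norm B * K"
    using bounded_bilinear.pos_bounded[OF bounded_bilinear_matrix_mult[where 'n='n]] by metis
  let ?C = "norm (mat 1 :: 'n cmat) + sqrt (real CARD('n))"
  \<comment> \<open>The equation for \<open>\<eta> t\<close> and boundedness of U(n) give distance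
    O(t) from the identity.\<close>
  have "\<forall>\<^sub>F t in nhds 0. norm (\<eta> t - mat 1) \<le> \<bar>t\<bar> / 2 * norm Y * ?C * K"
    using inv U
  proof eventually_elim
    case (elim t)
    have "norm (\<eta> t - mat 1) = norm (S t ** (mat 1 + \<eta> t))"
      using eq[OF elim(1)] by (metis add_diff_cancel_left')
    also have "\<dots> \<le> norm (S t) * norm (mat 1 + \<eta> t) * K" by (rule K)
    also have "\<dots> \<le> (\<bar>t\<bar> / 2 * norm Y) * ?C * K"
      using K(1) norm_triangle_ineq[of "mat 1" "\<eta> t"] norm_Ugrp[OF elim(2)]
      by (intro mult_mono) (auto simp: S_def)
    finally show ?case .
  qed
  then have "\<forall>\<^sub>F t in at 0. norm (\<eta> t - mat 1) \<le> \<bar>t\<bar> / 2 * norm Y * ?C * K"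
    by (auto simp: eventually_at_filter elim: eventually_mono)
  moreover have "((\<lambda>t. \<bar>t\<bar> / 2 * norm Y * ?C * K) \<longlongrightarrow> 0) (at 0)"
    by (auto intro!: tendsto_eq_intros)
  ultimately have lim: "((\<lambda>t. \<eta> t - mat 1) \<longlongrightarrow> 0) (at 0)"
    by (rule Lim_null_comparison)
  \<comment> \<open>This is the error of the difference quotient: S(1 + \<eta>) - tY = (t/2) Y
    (\<eta> - 1), divided by |t|.\<close>
  have "((\<lambda>t. sgn t *\<^sub>R ((1 / 2) *\<^sub>R (Y ** (\<eta> t - mat 1)))) \<longlongrightarrow> 0) (at 0)"
  proof (rule Lim_null_comparison)
    show "\<forall>\<^sub>F t in at 0. norm (sgn t *\<^sub>R ((1 / 2) *\<^sub>R (Y ** (\<eta> t - mat 1)))) \<le> norm (Y ** (\<eta> t - mat 1))"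
      by (intro always_eventually allI) (auto simp: sgn_if)
    show "((\<lambda>t. norm (Y ** (\<eta> t - mat 1))) \<longlongrightarrow> 0) (at 0)"
      using matrix_mult.tendsto[OF tendsto_const lim] by (simp add: matrix_mult.zero_right tendsto_norm_zero)
  qed
  moreover have "\<forall>\<^sub>F t in at 0. sgn t *\<^sub>R ((1 / 2) *\<^sub>R (Y ** (\<eta> t - mat 1)))
      = (\<eta> t - \<eta> 0 - (t - 0) *\<^sub>R Y) /\<^sub>R norm (t - 0)"
  proof -
    have "\<forall>\<^sub>F t in at 0. mat 1 - S t \<in> GLn \<and> t \<noteq> 0"
      using inv by (auto simp: eventually_at_filter elim: eventually_mono)
    then show ?thesis
    proof eventually_elim
      case (elim t)
      have "\<eta> t - \<eta> 0 - t *\<^sub>R Y = S t ** (mat 1 + \<eta> t) - t *\<^sub>R Y"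
        using eq[of t] elim \<eta>0 by (metis add_diff_cancel_left')
      also have "\<dots> = S t ** (mat 1 + \<eta> t) - (t / 2) *\<^sub>R (Y + Y)"
        by (simp only: scaleR_add_right flip: scaleR_add_left) simp
      also have "S t ** (mat 1 + \<eta> t) - (t / 2) *\<^sub>R (Y + Y) = (t / 2) *\<^sub>R (Y ** (mat 1 + \<eta> t) - (Y + Y))"
        by (simp only: S_def matrix_mult.scaleR_left scaleR_diff_right)
      also have "\<dots> = t *\<^sub>R ((1 / 2) *\<^sub>R (Y ** (\<eta> t - mat 1)))"
        by (simp add: matrix_mult.add_right matrix_mult.diff_right)
      finally have "\<eta> t - \<eta> 0 - (t - 0) *\<^sub>R Y = t *\<^sub>R ((1 / 2) *\<^sub>R (Y ** (\<eta> t - mat 1)))"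
        by simp
      moreover have "sgn t = inverse \<bar>t\<bar> * t" by (simp add: sgn_if)
      ultimately show ?case by (simp only: scaleR_scaleR real_norm_def diff_0_right mult.assoc)
    qed
  qed
  ultimately have "((\<lambda>t. (\<eta> t - \<eta> 0 - (t - 0) *\<^sub>R Y) /\<^sub>R norm (t - 0)) \<longlongrightarrow> 0) (at 0)"
    by (rule Lim_transform_eventually)
  then show "(\<eta> has_vector_derivative Y) (at 0)"
    unfolding has_vector_derivative_def has_derivative_at_within
    by (simp add: bounded_linear_scaleR_left)
qed

section \<open>Consequences of invariance\<close>

lemma has_derivative_const_along_curve:
  fixes f :: "'a::real_normed_vector \<Rightarrow> real"
  assumes "(f has_derivative f') (at p)" "(c has_vector_derivative v) (at 0)" "c 0 = p"
    and "\<forall>\<^sub>F t in nhds 0. f (c t) = f p"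
  shows "f' v = 0"
proof -
  have "((\<lambda>t. f (c t)) has_real_derivative 0) (at 0) \<longleftrightarrow> ((\<lambda>t. f p) has_real_derivative 0) (at 0)"
    using assms(4) by (intro DERIV_cong_ev) auto
  then show ?thesis
    using has_real_derivative_along_curve[OF assms(1-3)] DERIV_unique by fastforce
qed

lemma Cinf_inv_has_derivative:
  assumes "F \<in> Cinf_inv" "(g, J) \<in> MM"
  obtains F' where "(F has_derivative F') (at (g, J))"
  using assms smooth_on_imp_has_derivative[OF _ open_MM] unfolding Cinf_inv_def by blast

lemma Cinf_inv_right_derivative:
  assumes F: "F \<in> Cinf_inv" "(g, J) \<in> MM" "(F has_derivative F') (at (g, J))" and Y: "adj Y = - Y"
  shows "F' (g ** Y, 0) = 0"
proof -
  \<comment> \<open>The generator is - Y because the action is through the inverse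
    \<open>adj (\<eta> t)\<close>, whose velocity is then Y.\<close>
  obtain \<eta> where \<eta>: "\<forall>\<^sub>F t in nhds 0. \<eta> t \<in> Ugrp" "\<eta> 0 = mat 1" "(\<eta> has_vector_derivative - Y) (at 0)"
    using unitary_curve[of "- Y"] Y by (auto simp: adj_linear)
  have "((\<lambda>t. adj (\<eta> t)) has_vector_derivative Y) (at 0)"
    using bounded_linear.has_vector_derivative[OF bounded_linear_adj \<eta>(3)] Y by (simp add: adj_linear)
  then have "((\<lambda>t. (g ** adj (\<eta> t), J)) has_vector_derivative (g ** Y, 0)) (at 0)"
    by (intro has_vector_derivative_Pair has_vector_derivative_const
        bounded_linear.has_vector_derivative[OF matrix_mult.bounded_linear_right])
  moreover have "\<forall>\<^sub>F t in nhds 0. F (g ** adj (\<eta> t), J) = F (g, J)"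
    using \<eta>(1)
  proof eventually_elim
    case (elim t)
    then show ?case using F(1,2) unfolding Cinf_inv_def by (force simp flip: matrix_inv_Ugrp)
  qed
  ultimately show ?thesis
    using has_derivative_const_along_curve[OF F(3)] by (simp add: \<eta>(2))
qed

text \<open>The unitary curve moves g with velocity Y g and J, by conjugation, with velocity
  [Y, J].\<close>

lemma Cinf_inv_left_derivative:
  fixes Y :: "'n::finite cmat"
  assumes F: "F \<in> Cinf_inv" "(g, J) \<in> MM" "(F has_derivative F') (at (g, J))" and Y: "adj Y = - Y"
  shows "F' (Y ** g, comm Y J) = 0"
proof -
  obtain \<eta> where \<eta>: "\<forall>\<^sub>F t in nhds 0. \<eta> t \<in> Ugrp" "\<eta> 0 = mat 1" "(\<eta> has_vector_derivative Y) (at 0)"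
    using unitary_curve[OF Y] .
  have left: "((\<lambda>t. \<eta> t ** M) has_vector_derivative Y ** M) (at 0)" for M :: "'n cmat"
    by (rule bounded_linear.has_vector_derivative[OF matrix_mult.bounded_linear_left \<eta>(3)])
  have "((\<lambda>t. adj (\<eta> t)) has_vector_derivative - Y) (at 0)"
    using bounded_linear.has_vector_derivative[OF bounded_linear_adj \<eta>(3)] Y by simp
  from matrix_mult.has_vector_derivative[OF left[of J] this]
  have "((\<lambda>t. \<eta> t ** J ** adj (\<eta> t)) has_vector_derivative comm Y J) (at 0)"
    by (simp add: \<eta>(2) comm_def matrix_mult.minus_right)
  with left[of g]
  have "((\<lambda>t. (\<eta> t ** g, \<eta> t ** J ** adj (\<eta> t))) has_vector_derivative (Y ** g, comm Y J)) (at 0)"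
    by (rule has_vector_derivative_Pair)
  moreover have "\<forall>\<^sub>F t in nhds 0. F (\<eta> t ** g, \<eta> t ** J ** adj (\<eta> t)) = F (g, J)"
    using \<eta>(1)
  proof eventually_elim
    case (elim t)
    then show ?case using F(1,2) unfolding Cinf_inv_def by (force simp flip: matrix_inv_Ugrp)
  qed
  ultimately show ?thesis
    using has_derivative_const_along_curve[OF F(3)] by (simp add: \<eta>(2))
qed

section \<open>Exponentials of real diagonal matrices and regularity\<close>

lemma G0minus_nth:
  assumes "q \<in> G0minus"
  shows "q $ i $ j = (if i = j then complex_of_real (Re (q $ i $ i)) else 0)"
proof -
  have "cnj (q $ i $ i) = q $ i $ i"
    using assms unfolding G0minus_def adj_def by (auto simp: vec_eq_iff)
  then show ?thesis
    using assms by (auto simp: G0minus_def complex_eq_iff)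
qed

lemma mexp_G0minus_nth:
  assumes "q \<in> G0minus"
  shows "mexp q $ i $ j = (if i = j then complex_of_real (exp (Re (q $ i $ i))) else 0)"
  using mexp_diagonal[of q i j] G0minus_nth[OF assms, of i i] assms
  by (metis (mono_tags, lifting) G0minus_nth exp_of_real)

lemma G0minus_linear:
  "q \<in> G0minus \<Longrightarrow> X \<in> G0minus \<Longrightarrow> q + X \<in> G0minus"
  "X \<in> G0minus \<Longrightarrow> r *\<^sub>R X \<in> G0minus"
  "X \<in> G0minus \<Longrightarrow> - X \<in> G0minus"
  by (auto simp: G0minus_def adj_linear)

lemma matrix_mult_mexp_G0minus:
  assumes "q \<in> G0minus"
  shows "(X ** mexp q) $ i $ j = X $ i $ j * complex_of_real (exp (Re (q $ j $ j)))"
    and "(mexp q ** X) $ i $ j = complex_of_real (exp (Re (q $ i $ i))) * X $ i $ j"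
  by (simp_all add: matrix_matrix_mult_def mexp_G0minus_nth[OF assms] if_distrib[of "(*) _"]
      if_distrib[of "\<lambda>x. x * _"] cong: if_cong)

lemma mexp_minus_G0minus:
  assumes "q \<in> G0minus"
  shows "mexp (- q) ** mexp q = mat 1"
  by (simp add: vec_eq_iff matrix_mult_mexp_G0minus[OF assms] mexp_G0minus_nth[OF G0minus_linear(3)[OF assms]]
      mat_def exp_minus flip: of_real_mult)

lemma mexp_G0minus_in_MM:
  assumes "q \<in> G0minus"
  shows "(mexp q, J) \<in> MM"
  using mexp_minus_G0minus[OF assms] by (auto simp: MM_def GLn_def invertible_left_inverse)

text \<open>At a base point other than 0 this rests on q and X both being diagonal: only scalar
  exponentials are differentiated.\<close>

lemma has_vector_derivative_mexp_G0minus: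
  assumes "q \<in> G0minus" "X \<in> G0minus"
  shows "((\<lambda>t. mexp (q + t *\<^sub>R X)) has_vector_derivative X ** mexp q) (at 0)"
proof (intro has_vector_derivative_vec)
  fix i j
  have q: "q + t *\<^sub>R X \<in> G0minus" for t
    using assms by (simp add: G0minus_linear)
  have "((\<lambda>t. exp (Re (q $ i $ i) + t * Re (X $ i $ i))) has_vector_derivative
      exp (Re (q $ i $ i)) * Re (X $ i $ i)) (at 0)"
    by (auto intro!: derivative_eq_intros simp flip: has_real_derivative_iff_has_vector_derivative)
  then have "((\<lambda>t. complex_of_real (exp (Re (q $ i $ i) + t * Re (X $ i $ i)))) has_vector_derivative
      complex_of_real (exp (Re (q $ i $ i)) * Re (X $ i $ i))) (at 0)"
    by (rule bounded_linear.has_vector_derivative[OF bounded_linear_of_real])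
  then show "((\<lambda>t. mexp (q + t *\<^sub>R X) $ i $ j) has_vector_derivative (X ** mexp q) $ i $ j) (at 0)"
    using G0minus_nth[OF assms(2), of i j]
    by (cases "i = j") (simp_all add: mexp_G0minus_nth[OF q] matrix_mult_mexp_G0minus[OF assms(1)] mult.commute)
qed

text \<open>Regularity consists of finitely many strict inequalities, so it is open along lines in
  \<open>G0minus\<close>. Hence the value 0 of \<open>red\<close> off \<open>M0reg\<close> does not
  affect derivatives in q.\<close>

lemma eventually_regq:
  assumes "regq q" "X \<in> G0minus"
  shows "\<forall>\<^sub>F t in nhds 0. regq (q + t *\<^sub>R X)"
proof -
  have "\<forall>\<^sub>F t in nhds 0. i < j \<longrightarrow> Re ((q + t *\<^sub>R X) $ j $ j) < Re ((q + t *\<^sub>R X) $ i $ i)" for i j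
  proof (cases "i < j")
    case True
    have "((\<lambda>t. Re ((q + t *\<^sub>R X) $ k $ k)) \<longlongrightarrow> Re (q $ k $ k)) (nhds 0)" for k
      by (auto intro!: tendsto_eq_intros filterlim_ident)
    from order_tendstoD(1)[OF tendsto_diff[OF this[of i] this[of j]], of 0]
    have "\<forall>\<^sub>F t in nhds 0. 0 < Re ((q + t *\<^sub>R X) $ i $ i) - Re ((q + t *\<^sub>R X) $ j $ j)"
      using True assms(1) by (simp add: regq_def)
    then show ?thesis by eventually_elim simp
  qed simp
  then have "\<forall>\<^sub>F t in nhds 0. \<forall>i j. i < j \<longrightarrow> Re ((q + t *\<^sub>R X) $ j $ j) < Re ((q + t *\<^sub>R X) $ i $ i)"
    by (intro eventually_all_finite)
  then show ?thesis
    by eventually_elim (use assms in \<open>auto simp: regq_def G0minus_linear\<close>)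
qed

section \<open>Derivatives of restrictions and the decomposition of the left gradient\<close>

lemma red_mexp: "regq q \<Longrightarrow> red F (mexp q, J) = F (mexp q, J)"
  by (auto simp: red_def M0reg_def)

text \<open>J is unrestricted in \<open>M0reg\<close>, so both definite descriptions have the same
  defining predicate.\<close>

lemma red_d2_red: "regq q \<Longrightarrow> red_d2 (red F) q J = d2 F (mexp q, J)"
  by (simp add: red_d2_def d2_def red_mexp)

lemma diag_part_mpart_G0minus: "diag_part (mpart X) \<in> G0minus"
  by (auto simp: G0minus_def diag_part_def mpart_def adj_def vec_eq_iff)

lemma ip_diag_part_mpart:
  assumes "X \<in> G0minus"
  shows "ip (diag_part (mpart A)) X = ip A X"
proof -
  have "diag_part X = X"
    using assms by (auto simp: vec_eq_iff diag_part_def G0minus_def)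
  moreover have "ip (diag_part M) X = ip M (diag_part X)" for M
    by (auto simp: ip_def trace_def matrix_matrix_mult_def diag_part_def intro!: sum.cong)
  moreover have "mpart X = X"
    using assms by (simp add: mpart_def G0minus_def scaleR_2[symmetric])
  ultimately show ?thesis by (simp add: ip_mpart)
qed

text \<open>Moving q by a diagonal X gives g the velocity X g, exactly as left translation does. The
  reduced gradient is therefore the left gradient projected to \<open>G0minus\<close>.\<close>

lemma red_nabla1_red:
  assumes F: "F \<in> Cinf_inv" and q: "regq q"
  shows "red_nabla1 (red F) q J = diag_part (mpart (nabla1 F (mexp q, J)))"
proof -
  let ?A = "nabla1 F (mexp q, J)"
  have q0: "q \<in> G0minus" using q by (simp add: regq_def)
  obtain F' where F': "(F has_derivative F') (at (mexp q, J))"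
    using Cinf_inv_has_derivative[OF F mexp_G0minus_in_MM[OF q0]] .
  have deriv: "((\<lambda>t. red F (mexp (q + t *\<^sub>R X), J)) has_real_derivative ip ?A X) (at 0)"
    if X: "X \<in> G0minus" for X
  proof -
    have "((\<lambda>t. (mexp (q + t *\<^sub>R X), J)) has_vector_derivative (X ** mexp q, 0)) (at 0)"
      by (intro has_vector_derivative_Pair has_vector_derivative_const
          has_vector_derivative_mexp_G0minus q0 X)
    from has_real_derivative_along_curve[OF F' this]
    have "((\<lambda>t. F (mexp (q + t *\<^sub>R X), J)) has_real_derivative ip ?A X) (at 0)"
      by (simp add: ip_nabla1[OF F'])
    moreover have ev: "\<forall>\<^sub>F t in nhds 0. red F (mexp (q + t *\<^sub>R X), J) = F (mexp (q + t *\<^sub>R X), J)"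
      using eventually_regq[OF q X] by eventually_elim (rule red_mexp)
    ultimately show ?thesis
      using DERIV_cong_ev[OF refl ev refl] by simp
  qed
  show ?thesis
    unfolding red_nabla1_def
  proof (rule the_equality)
    show "diag_part (mpart ?A) \<in> G0minus \<and> (\<forall>X0\<in>G0minus.
        ((\<lambda>t. red F (mexp (q + t *\<^sub>R X0), J)) has_real_derivative ip (diag_part (mpart ?A)) X0) (at 0))"
      using deriv by (simp add: diag_part_mpart_G0minus ip_diag_part_mpart)
  next
    fix Z
    assume Z: "Z \<in> G0minus \<and> (\<forall>X0\<in>G0minus.
        ((\<lambda>t. red F (mexp (q + t *\<^sub>R X0), J)) has_real_derivative ip Z X0) (at 0))"
    \<comment> \<open>The difference is tested against itself: on Hermitian matrices the form is the
      positive definite inner product.\<close>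
    let ?D = "Z - diag_part (mpart ?A)"
    have D: "?D \<in> G0minus"
      using Z G0minus_linear(1)[OF _ G0minus_linear(3)[OF diag_part_mpart_G0minus[of ?A]]] by auto
    have "ip Z ?D = ip ?A ?D"
      using Z deriv[OF D] D DERIV_unique by blast
    then have "ip ?D ?D = 0"
      using ip_diag_part_mpart[OF D, of ?A] by (simp only: ip_linear(2))
    then have "?D \<bullet> ?D = 0"
      using D by (simp add: ip_eq_inner G0minus_def)
    then show "Z = diag_part (mpart ?A)" by simp
  qed
qed

text \<open>Left invariance reads <A, Y> + <B, [Y, J]> = 0 for Y in u(n), with A and B the two
  gradients; invariance of the form turns the second term into - <[B, J], Y>.\<close>

lemma ppart_nabla1:
  assumes F: "F \<in> Cinf_inv" and p: "(g, J) \<in> MM"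
  shows "ppart (nabla1 F (g, J)) = ppart (comm (d2 F (g, J)) J)"
proof (rule ppart_eqI)
  fix Y :: "'a cmat" assume Y: "adj Y = - Y"
  let ?A = "nabla1 F (g, J)" and ?B = "d2 F (g, J)"
  obtain F' where F': "(F has_derivative F') (at (g, J))"
    using Cinf_inv_has_derivative[OF F p] .
  have "F' (Y ** g, comm Y J) = F' (Y ** g, 0) + F' (0, comm Y J)"
    using linear_add[OF has_derivative_linear[OF F'], of "(Y ** g, 0)" "(0, comm Y J)"] by simp
  then have "ip ?A Y + ip ?B (comm Y J) = 0"
    using Cinf_inv_left_derivative[OF F p F' Y] by (simp add: ip_nabla1[OF F'] ip_d2[OF F'])
  then show "ip ?A Y = ip (comm ?B J) Y"
    by (simp add: ip_comm_cyclic comm_swap[of Y J] ip_linear)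
qed

text \<open>The right velocity g Y is (g Y g^-1) g, so the left gradient pairs to zero with g Y
  g^-1; cyclicity of the trace moves the conjugation onto the gradient.\<close>

lemma ppart_conj_nabla1:
  assumes F: "F \<in> Cinf_inv" and q: "q \<in> G0minus"
  shows "ppart (mexp (- q) ** nabla1 F (mexp q, J) ** mexp q) = 0"
proof -
  let ?A = "nabla1 F (mexp q, J)"
  have p: "(mexp q, J) \<in> MM" by (rule mexp_G0minus_in_MM[OF q])
  obtain F' where F': "(F has_derivative F') (at (mexp q, J))"
    using Cinf_inv_has_derivative[OF F p] .
  have "ppart (mexp (- q) ** ?A ** mexp q) = ppart 0"
  proof (rule ppart_eqI)
    fix Y :: "'a cmat" assume Y: "adj Y = - Y"
    have "ip (mexp (- q) ** ?A ** mexp q) Y = ip ?A (mexp q ** Y ** mexp (- q))"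
      unfolding ip_def using trace_mul_sym[of "mexp (- q)" "?A ** mexp q ** Y"]
      by (simp add: matrix_mul_assoc)
    also have "\<dots> = F' (mexp q ** Y ** (mexp (- q) ** mexp q), 0)"
      by (simp add: ip_nabla1[OF F'] matrix_mul_assoc)
    also have "\<dots> = 0"
      using Cinf_inv_right_derivative[OF F p F' Y] by (simp add: mexp_minus_G0minus[OF q])
    finally show "ip (mexp (- q) ** ?A ** mexp q) Y = ip 0 Y" by simp
  qed
  also have "ppart (0 :: 'a cmat) = 0" by (simp add: ppart_def adj_def vec_eq_iff)
  finally show ?thesis .
qed

lemma ppart_eq_0_nth:
  assumes "ppart X = 0"
  shows "X $ i $ j = cnj (X $ j $ i)"
proof -
  have "adj X = X" using assms by (simp add: ppart_def)
  then have "adj X $ i $ j = X $ i $ j" by (simp only:)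
  then show ?thesis by (simp add: adj_def)
qed

lemma mpart_eq_Rop_ppart:
  assumes q: "regq q" and A: "ppart (mexp (- q) ** A ** mexp q) = 0"
  shows "mpart A = diag_part (mpart A) + Rop q (ppart A)"
proof -
  have q0: "q \<in> G0minus" using q by (simp add: regq_def)
  have "mpart A $ i $ j = (diag_part (mpart A) + Rop q (ppart A)) $ i $ j" for i j
  proof (cases "i = j")
    case True
    then show ?thesis by (simp add: diag_part_def Rop_def)
  next
    case False
    define x where "x = Re (q $ i $ i) - Re (q $ j $ j)"
    \<comment> \<open>Regularity of q enters here: it permits the division by sinh x.\<close>
    have "x \<noteq> 0"
      using q False unfolding regq_def x_def by (metis linorder_neqE less_irrefl eq_iff_diff_eq_0)
    then have sinh: "sinh x \<noteq> 0" by simp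
    define P M where "P = ppart A $ i $ j" and "M = mpart A $ i $ j"
    \<comment> \<open>Conjugate transposition fixes the Hermitian part and negates the
      anti-Hermitian one.\<close>
    have Aij: "A $ i $ j = M + P" and Aji: "cnj (A $ j $ i) = M - P"
      by (simp_all add: P_def M_def ppart_def mpart_def adj_def scaleR_conv_of_real[where 'a=complex] field_simps)
    have ex: "exp (- Re (q $ i $ i)) * exp (Re (q $ j $ j)) = exp (- x)"
      "exp (- Re (q $ j $ j)) * exp (Re (q $ i $ i)) = exp x"
      by (simp_all add: x_def flip: exp_add)
    have nth: "(mexp (- q) ** A ** mexp q) $ k $ l
        = complex_of_real (exp (- Re (q $ k $ k)) * exp (Re (q $ l $ l))) * A $ k $ l" for k l
      by (simp add: matrix_mult_mexp_G0minus[OF q0] matrix_mult_mexp_G0minus[OF G0minus_linear(3)[OF q0]])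
    have "(mexp (- q) ** A ** mexp q) $ i $ j = cnj ((mexp (- q) ** A ** mexp q) $ j $ i)"
      by (rule ppart_eq_0_nth[OF A])
    then have "of_real (exp (- x)) * (M + P) = of_real (exp x) * (M - P)"
      by (simp only: nth ex complex_cnj_mult complex_cnj_complex_of_real Aij Aji)
    then have "of_real (exp x - exp (- x)) * M = of_real (exp x + exp (- x)) * P"
      by (simp add: algebra_simps)
    moreover have "exp x - exp (- x) = 2 * sinh x" "exp x + exp (- x) = 2 * cosh x"
      by (simp_all add: sinh_field_def cosh_field_def)
    ultimately have "of_real (sinh x) * M = of_real (cosh x) * P"
      by simp
    then have "M = P * of_real (coth x)"
      using sinh by (simp add: coth_def field_simps)
    then show ?thesis
      using False by (simp add: diag_part_def Rop_def x_def P_def M_def)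
  qed
  then show ?thesis by (simp add: vec_eq_iff)
qed

text \<open>The full left gradient is recovered from reduced data alone, which is why the bracket
  descends to restrictions.\<close>

lemma nabla1_decomposition:
  assumes F: "F \<in> Cinf_inv" and q: "regq q"
  shows "nabla1 F (mexp q, J) = red_nabla1 (red F) q J
    + Rop q (ppart (comm (red_d2 (red F) q J) J)) + ppart (comm (red_d2 (red F) q J) J)"
proof -
  let ?A = "nabla1 F (mexp q, J)"
  have q0: "q \<in> G0minus" using q by (simp add: regq_def)
  have "mpart ?A = diag_part (mpart ?A) + Rop q (ppart ?A)"
    by (rule mpart_eq_Rop_ppart[OF q ppart_conj_nabla1[OF F q0]])
  then have mpart: "mpart ?A = red_nabla1 (red F) q J + Rop q (ppart (comm (red_d2 (red F) q J) J))"
    by (simp only: red_nabla1_red[OF F q] red_d2_red[OF q] ppart_nabla1[OF F mexp_G0minus_in_MM[OF q0]])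
  have "?A = mpart ?A + ppart ?A"
    by (subst add.commute) (rule ppart_plus_mpart)
  also have "\<dots> = red_nabla1 (red F) q J + Rop q (ppart (comm (red_d2 (red F) q J) J))
      + ppart (comm (red_d2 (red F) q J) J)"
    by (simp only: mpart red_d2_red[OF q] ppart_nabla1[OF F mexp_G0minus_in_MM[OF q0]])
  finally show ?thesis .
qed

section \<open>The reduced bracket\<close>

lemma adj_comm_ppart: "adj (comm (ppart X) (ppart Y)) = - comm (ppart X) (ppart Y)"
  by (simp add: comm_def adj_linear adj_mult adj_ppart matrix_mult.minus_left matrix_mult.minus_right)

lemma adj_comm_mpart: "adj (comm (mpart X) (mpart Y)) = - comm (mpart X) (mpart Y)"
  by (simp add: comm_def adj_linear adj_mult adj_mpart)

lemma ip_red_nabla1: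
  assumes "F \<in> Cinf_inv" "regq q"
  shows "ip (red_nabla1 (red F) q J) X = ip (red_nabla1 (red F) q J) (diag_part (mpart X))"
proof -
  have "red_nabla1 (red F) q J \<in> G0minus"
    by (simp only: red_nabla1_red[OF assms] diag_part_mpart_G0minus)
  from ip_diag_part_mpart[OF this, of X] show ?thesis
    by (simp only: ip_commute[of "red_nabla1 (red F) q J"])
qed

lemma coth_minus: "coth (- x) = - coth x"
  by (simp add: coth_def)

lemma coth_diff_swap: "coth (x - y) = - coth (y - x)"
  using coth_minus[of "y - x"] by simp

text \<open>coth is odd, so the multiplier changes sign under transposition; hence R(q) interchanges
  Hermitian and anti-Hermitian matrices.\<close>

lemma adj_Rop: "adj (Rop q X) = - Rop q (adj X)"
proof -
  have "adj (Rop q X) $ i $ j = (- Rop q (adj X)) $ i $ j" for i j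
    using coth_diff_swap[of "Re (q $ j $ j)" "Re (q $ i $ i)"] by (simp add: adj_def Rop_def)
  then show ?thesis by (simp only: vec_eq_iff) simp
qed

lemma Rop_minus: "Rop q (- X) = - Rop q X"
  by (simp add: Rop_def vec_eq_iff)

text \<open>The trace pairs the entries (i,k) and (k,i), whose multipliers are opposite.\<close>

lemma ip_Rop: "ip (Rop q X) Y = - ip X (Rop q Y)"
proof -
  have "Rop q X $ i $ k * Y $ k $ i = - (X $ i $ k * Rop q Y $ k $ i)" for i k
    using coth_diff_swap[of "Re (q $ i $ i)" "Re (q $ k $ k)"] by (simp add: Rop_def algebra_simps)
  then show ?thesis
    by (simp only: ip_def trace_def matrix_matrix_mult_def vec_lambda_beta sum_negf uminus_complex.sel)
qed

lemma ip_Rop_ppart: "ip (Rop q (ppart X)) Y = ip (Rop q (ppart X)) (mpart Y)"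
proof -
  have "adj (Rop q (ppart X)) = Rop q (ppart X)"
    by (simp add: adj_Rop adj_ppart Rop_minus)
  then have "mpart (Rop q (ppart X)) = Rop q (ppart X)"
    by (simp add: mpart_def flip: scaleR_2)
  then show ?thesis using ip_mpart[of "Rop q (ppart X)" Y] by simp
qed

text \<open>The three summands of the gradient are diagonal Hermitian, Hermitian and anti-Hermitian,
  and each sees only the matching part of X.\<close>

lemma ip_nabla1_red:
  assumes "F \<in> Cinf_inv" "regq q"
  shows "ip (nabla1 F (mexp q, J)) X = ip (red_nabla1 (red F) q J) (diag_part (mpart X))
    + ip (Rop q (ppart (comm (red_d2 (red F) q J) J))) (mpart X)
    + ip (comm (red_d2 (red F) q J) J) (ppart X)"
  by (simp only: nabla1_decomposition[OF assms] ip_linear ip_red_nabla1[OF assms, of _ X]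
      ip_Rop_ppart[of _ _ X] ip_ppart)

lemma PB1_reduced:
  fixes F H :: "'n::{finite,linorder} cmat \<times> 'n cmat \<Rightarrow> real" and J :: "'n cmat"
  assumes F: "F \<in> Cinf_inv" and H: "H \<in> Cinf_inv" and q: "regq q"
  defines "f \<equiv> red_d2 (red F) q J" and "h \<equiv> red_d2 (red H) q J"
  shows "PB1 F H (mexp q, J) =
           ip (red_nabla1 (red F) q J) (diag_part (mpart h))
         - ip (red_nabla1 (red H) q J) (diag_part (mpart f))
         + ip (Rop q (ppart (comm f J))) (mpart h)
         - ip (Rop q (ppart (comm h J))) (mpart f)
         + ip (ppart J) (comm (mpart f) (mpart h) - comm (ppart f) (ppart h))"
proof -
  let ?c = "comm (mpart f) (mpart h) - comm (ppart f) (ppart h)"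
  \<comment> \<open>These are the terms of the bracket free of R(q) and of reduced gradients;
    invariance of the form brings J into the first slot.\<close>
  have "ip (comm f J) (ppart h) - ip (comm h J) (ppart f) + ip J (comm f h)
      = ip J (comm (ppart h) f) - ip J (comm (ppart f) h) + ip J (comm f h)"
    using ip_comm_cyclic[of J "ppart h" f] ip_comm_cyclic[of J "ppart f" h]
      ip_comm_cyclic[of "ppart h" f J] ip_comm_cyclic[of "ppart f" h J]
    by (metis ip_comm_cyclic ip_commute)
  also have "\<dots> = ip J (comm (ppart h) f - comm (ppart f) h + comm f h)"
    by (simp only: ip_linear)
  \<comment> \<open>The mixed brackets cancel; [f^+, h^+] occurs with signs -, -, + and survives
    once with a minus.\<close>
  also have "comm (ppart h) f - comm (ppart f) h + comm f h = ?c"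
  proof -
    have fh: "comm (ppart h) f = comm (ppart h) (ppart f) + comm (ppart h) (mpart f)"
      "comm (ppart f) h = comm (ppart f) (ppart h) + comm (ppart f) (mpart h)"
      "comm f h = comm (ppart f) (ppart h) + comm (ppart f) (mpart h)
        + (comm (mpart f) (ppart h) + comm (mpart f) (mpart h))"
      by (simp_all flip: comm_linear ppart_plus_mpart)
    show ?thesis
      unfolding fh by (simp add: comm_swap[of "ppart h"])
  qed
  \<comment> \<open>Brackets of two Hermitian or two anti-Hermitian matrices lie in u(n), so only
    J^+ contributes.\<close>
  also have "ip J ?c = ip J (ppart ?c)"
    by (simp add: ppart_eq_self adj_linear adj_comm_ppart adj_comm_mpart)
  also have "\<dots> = ip (ppart J) ?c" by (simp only: ip_ppart)
  finally show ?thesis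
    by (simp add: PB1_def ip_nabla1_red[OF F q] ip_nabla1_red[OF H q]
        f_def h_def red_d2_red[OF q])
qed

text \<open>Formulated through the two infinitesimal properties that both families of trace
  functions share.\<close>

lemma PB1_reduced_central:
  fixes F H :: "'n::{finite,linorder} cmat \<times> 'n cmat \<Rightarrow> real" and J :: "'n cmat"
  assumes F: "F \<in> Cinf_inv" and q: "regq q"
    and H: "nabla1 H (mexp q, J) = 0" "comm (d2 H (mexp q, J)) J = 0"
  defines "h \<equiv> red_d2 (red H) q J"
  shows "PB1 F H (mexp q, J) =
             ip (red_nabla1 (red F) q J) (diag_part (mpart h))
           + ip (red_d2 (red F) q J) (comm (Rop q (mpart h) - ppart h) J)"
proof -
  let ?f = "red_d2 (red F) q J"
  have h: "d2 H (mexp q, J) = h" by (simp add: h_def red_d2_red[OF q])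
  \<comment> \<open>The Lie-Poisson term becomes a pairing with [h, J], which is zero.\<close>
  have "ip J (comm ?f h) = ip ?f (comm h J)"
    by (metis ip_comm_cyclic ip_commute)
  then have 1: "ip J (comm ?f h) = 0"
    using H(2) ip_commute[of ?f 0] by (simp add: h)
  have "adj (Rop q (mpart h)) = - Rop q (mpart h)"
    by (simp add: adj_Rop adj_mpart)
  then have "ip (Rop q (ppart (comm ?f J))) (mpart h) = - ip (comm ?f J) (Rop q (mpart h))"
    by (simp add: ip_Rop ip_ppart ppart_eq_self)
  moreover have "ip (comm ?f J) Z = - ip ?f (comm Z J)" for Z
    by (simp add: ip_comm_cyclic comm_swap[of Z] ip_linear)
  ultimately have "ip (Rop q (ppart (comm ?f J))) (mpart h) + ip (comm ?f J) (ppart h)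
      = ip ?f (comm (Rop q (mpart h) - ppart h) J)"
    by (simp add: comm_linear ip_linear)
  with 1 show ?thesis
    by (simp add: PB1_def ip_nabla1_red[OF F q] H(1) h red_d2_red[OF q])
qed

section \<open>Gradients of the power traces\<close>

lemma matpow_commute: "C ** J = J ** C \<Longrightarrow> C ** matpow J k = matpow J k ** C"
proof (induction k)
  case (Suc k)
  have "C ** (J ** matpow J k) = J ** (C ** matpow J k)"
    by (simp only: matrix_mul_assoc Suc.prems[symmetric])
  also have "\<dots> = J ** (matpow J k ** C)"
    by (simp only: Suc.IH[OF Suc.prems])
  finally show ?case by (simp add: matrix_mul_assoc)
qed simp

text \<open>Pairing with all C that commute with J, not just C = 1, is what makes the induction on k work.\<close>

lemma has_vector_derivative_matpow:
  fixes J X :: "'n::finite cmat"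
  obtains P where "((\<lambda>t. matpow (J + t *\<^sub>R X) k) has_vector_derivative P) (at 0)"
    and "\<And>C. C ** J = J ** C \<Longrightarrow> trace (C ** P) = of_nat k * trace (C ** matpow J (k - 1) ** X)"
proof -
  have "\<exists>P. ((\<lambda>t. matpow (J + t *\<^sub>R X) k) has_vector_derivative P) (at 0) \<and>
    (\<forall>C. C ** J = J ** C \<longrightarrow> trace (C ** P) = of_nat k * trace (C ** matpow J (k - 1) ** X))"
  proof (induction k)
    case 0
    show ?case
      by (rule exI[of _ 0]) (simp add: matrix_mult.zero_right trace_def)
  next
    case (Suc k)
    then obtain P where P: "((\<lambda>t. matpow (J + t *\<^sub>R X) k) has_vector_derivative P) (at 0)"
      and tr: "\<And>C. C ** J = J ** C \<Longrightarrow> trace (C ** P) = of_nat k * trace (C ** matpow J (k - 1) ** X)"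
      by blast
    have "((\<lambda>t. J + t *\<^sub>R X) has_vector_derivative X) (at 0)"
      by (auto intro!: derivative_eq_intros)
    from matrix_mult.has_vector_derivative[OF this P]
    have "((\<lambda>t. matpow (J + t *\<^sub>R X) (Suc k)) has_vector_derivative J ** P + X ** matpow J k) (at 0)"
      by simp
    moreover have "trace (C ** (J ** P + X ** matpow J k)) = of_nat (Suc k) * trace (C ** matpow J k ** X)"
      if C: "C ** J = J ** C" for C
    proof -
      \<comment> \<open>C J again commutes with J, so the induction hypothesis applies to
        it.\<close>
      have "(C ** J) ** J = J ** (C ** J)" by (simp only: matrix_mul_assoc C[symmetric])
      then have "trace (C ** J ** P) = of_nat k * trace (C ** J ** matpow J (k - 1) ** X)"
        by (rule tr)
      \<comment> \<open>At k = 0 the factor \<open>of_nat k\<close> vanishes, so the truncated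
        exponent \<open>k - 1\<close> is harmless; otherwise J is absorbed into the power.\<close>
      also have "\<dots> = of_nat k * trace (C ** matpow J k ** X)"
        by (cases k) (simp_all add: matrix_mul_assoc)
      finally have 1: "trace (C ** J ** P) = of_nat k * trace (C ** matpow J k ** X)" .
      have "trace (C ** X ** matpow J k) = trace (matpow J k ** (C ** X))"
        by (rule trace_mul_sym)
      also have "\<dots> = trace (C ** matpow J k ** X)"
        using matpow_commute[OF C, of k] by (simp add: matrix_mul_assoc)
      finally show ?thesis
        using 1 by (simp add: matrix_mult.add_right trace_add matrix_mul_assoc algebra_simps)
    qed
    ultimately show ?case by auto
  qed
  then show ?thesis using that by blast
qed

lemma bounded_linear_trace: "bounded_linear (trace :: 'n::finite cmat \<Rightarrow> complex)"
  unfolding linear_conv_bounded_linear[symmetric]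
  by (auto intro!: linearI simp: trace_def sum.distrib scaleR_right.sum)

lemma has_vector_derivative_trace_matpow:
  fixes J X :: "'n::finite cmat"
  shows "((\<lambda>t. trace (matpow (J + t *\<^sub>R X) k)) has_vector_derivative
    of_nat k * trace (matpow J (k - 1) ** X)) (at 0)"
proof -
  obtain P where P: "((\<lambda>t. matpow (J + t *\<^sub>R X) k) has_vector_derivative P) (at 0)"
    and tr: "\<And>C. C ** J = J ** C \<Longrightarrow> trace (C ** P) = of_nat k * trace (C ** matpow J (k - 1) ** X)"
    by (rule has_vector_derivative_matpow) blast
  from bounded_linear.has_vector_derivative[OF bounded_linear_trace P] tr[of "mat 1"]
  show ?thesis by simp
qed

lemma d2_Hk:
  assumes "k \<ge> 1"
  shows "d2 (Hk k) (g, J) = matpow J (k - 1)"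
proof (rule d2_eqI)
  fix X
  have "((\<lambda>t. Re (trace (matpow (J + t *\<^sub>R X) k))) has_vector_derivative
      Re (of_nat k * trace (matpow J (k - 1) ** X))) (at 0)"
    by (rule bounded_linear.has_vector_derivative[OF bounded_linear_Re has_vector_derivative_trace_matpow])
  then have "((\<lambda>t. Re (trace (matpow (J + t *\<^sub>R X) k)) / real k) has_real_derivative
      Re (of_nat k * trace (matpow J (k - 1) ** X)) / real k) (at 0)"
    by (intro DERIV_cdivide) (simp add: has_real_derivative_iff_has_vector_derivative)
  then show "((\<lambda>t. Hk k (g, J + t *\<^sub>R X)) has_real_derivative ip (matpow J (k - 1)) X) (at 0)"
    using assms by (simp add: Hk_def ip_def)
qed

text \<open>Complex scalar multiples are expressed as products with the scalar matrix
  \<open>mat c\<close>.\<close>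

lemma mat_mult_nth:
  fixes M :: "'n::finite cmat"
  shows "(mat c ** M) $ i $ j = c * M $ i $ j" "(M ** mat c) $ i $ j = c * M $ i $ j"
  by (simp_all add: matrix_matrix_mult_def mat_def if_distrib[of "(*) _"]
      if_distrib[of "\<lambda>x. x * _"] mult.commute cong: if_cong)

text \<open>Im z = Re(- \<i> z) accounts for the scalar factor.\<close>

lemma d2_Htk:
  assumes "k \<ge> 1"
  shows "d2 (Htk k) (g, J) = mat (- \<i>) ** matpow J (k - 1)"
proof (rule d2_eqI)
  fix X
  have "((\<lambda>t. Im (trace (matpow (J + t *\<^sub>R X) k))) has_vector_derivative
      Im (of_nat k * trace (matpow J (k - 1) ** X))) (at 0)"
    by (rule bounded_linear.has_vector_derivative[OF bounded_linear_Im has_vector_derivative_trace_matpow])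
  then have "((\<lambda>t. Im (trace (matpow (J + t *\<^sub>R X) k)) / real k) has_real_derivative
      Im (of_nat k * trace (matpow J (k - 1) ** X)) / real k) (at 0)"
    by (intro DERIV_cdivide) (simp add: has_real_derivative_iff_has_vector_derivative)
  moreover have "trace (mat (- \<i>) ** matpow J (k - 1) ** X) = - \<i> * trace (matpow J (k - 1) ** X)"
    unfolding matrix_mul_assoc[symmetric] by (simp only: trace_def mat_mult_nth sum_distrib_left)
  ultimately show "((\<lambda>t. Htk k (g, J + t *\<^sub>R X)) has_real_derivative
      ip (mat (- \<i>) ** matpow J (k - 1)) X) (at 0)"
    using assms by (simp add: Htk_def ip_def)
qed

lemma comm_matpow: "comm (matpow J k) J = 0"
  using matpow_commute[of J J k] by (simp add: comm_def)

lemma comm_mat_mult: "comm (mat c ** M) J = mat c ** comm M J"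
proof -
  have "J ** mat c = mat c ** J" by (simp add: vec_eq_iff mat_mult_nth)
  then have "J ** (mat c ** M) = mat c ** (J ** M)" by (simp add: matrix_mul_assoc)
  then show ?thesis by (simp add: comm_def matrix_mult.diff_right matrix_mul_assoc)
qed

lemma nabla1_Hk: "nabla1 (Hk k) (g, J) = 0" and nabla1_Htk: "nabla1 (Htk k) (g, J) = 0"
  by (rule nabla1_eqI; simp add: Hk_def Htk_def)+

theorem theorem3p4:
  fixes F H :: "'n::{finite,linorder} cmat \<times> 'n cmat \<Rightarrow> real"
    and q J :: "'n cmat"
  assumes "F \<in> Cinf_inv" and "H \<in> Cinf_inv" and "regq q"
  shows "(PB1 F H (mexp q, J) =
           ip (red_nabla1 (red F) q J) (diag_part (mpart (red_d2 (red H) q J)))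
         - ip (red_nabla1 (red H) q J) (diag_part (mpart (red_d2 (red F) q J)))
         + ip (Rop q (ppart (comm (red_d2 (red F) q J) J))) (mpart (red_d2 (red H) q J))
         - ip (Rop q (ppart (comm (red_d2 (red H) q J) J))) (mpart (red_d2 (red F) q J))
         + ip (ppart J) (comm (mpart (red_d2 (red F) q J)) (mpart (red_d2 (red H) q J))
                         - comm (ppart (red_d2 (red F) q J)) (ppart (red_d2 (red H) q J))))
         \<and> (\<forall>k\<ge>1. \<forall>H' \<in> {Hk k, Htk k}.
           PB1 F H' (mexp q, J) =
             ip (red_nabla1 (red F) q J) (diag_part (mpart (red_d2 (red H') q J)))
           + ip (red_d2 (red F) q J)
                (comm (Rop q (mpart (red_d2 (red H') q J)) - ppart (red_d2 (red H') q J)) J))"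
proof (intro conjI allI impI ballI)
  fix k :: nat and H' :: "'n cmat \<times> 'n cmat \<Rightarrow> real"
  assume "k \<ge> 1" "H' \<in> {Hk k, Htk k}"
  then have "nabla1 H' (mexp q, J) = 0" "comm (d2 H' (mexp q, J)) J = 0"
    by (auto simp: nabla1_Hk nabla1_Htk d2_Hk d2_Htk comm_mat_mult comm_matpow matrix_mult.zero_right)
  then show "PB1 F H' (mexp q, J) =
      ip (red_nabla1 (red F) q J) (diag_part (mpart (red_d2 (red H') q J)))
    + ip (red_d2 (red F) q J)
         (comm (Rop q (mpart (red_d2 (red H') q J)) - ppart (red_d2 (red H') q J)) J)"
    by (rule PB1_reduced_central[OF assms(1,3)])
qed (rule PB1_reduced[OF assms])

end
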